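(* Let $T:[0,1)^2\to[0,1)^2$, $T(x,y)=(y,\{-x-\sqrt2y\})$ (the map associated with $\lambda=-\sqrt2$). Then $\pi(z)$ is finite for all $z\in(\mathbb Z[\sqrt2]\cap[0,1))^2$, but $\left(T^k\left(\frac34,\frac{5-\sqrt2}4\right)\right)_{k\in\mathbb Z}$ is aperiodic.
   Context: $\{u\}=u-\lfloor u\rfloor$ is the fractional part. $T$ is a bijection of $[0,1)^2$. $\pi(z)$ is the least $p\ge1$ with $T^p(z)=z$, and $\pi(z)=\infty$ (the sequence $(T^k(z))_{k\in\mathbb Z}$ is aperiodic) if no such $p$ exists. *)

theory Defs
  imports Complex_Main "HOL-Library.Extended_Nat"
begin

definition unit_square :: "(real \<times> real) set" where
  "unit_square = {0..<1} \<times> {0..<1}"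

definition Z_sqrt2 :: "real set" where
  "Z_sqrt2 = {of_int a + of_int b * sqrt 2 | a b :: int. True}"

text \<open>As a HOL function \<open>T\<close> is total, but it is only used on the unit square, which it
  permutes (see \<open>bij_betw_T\<close>).\<close>

definition T :: "real \<times> real \<Rightarrow> real \<times> real" where
  "T = (\<lambda>(x, y). (y, frac (- x - sqrt 2 * y)))"

text \<open>Integer iterates; the inverse is that of \<open>T\<close> as a bijection of the unit square.\<close>

definition T_pow :: "int \<Rightarrow> real \<times> real \<Rightarrow> real \<times> real" where
  "T_pow k = (if 0 \<le> k then T ^^ nat k else inv_into unit_square T ^^ nat (- k))"

definition period :: "real \<times> real \<Rightarrow> enat" where
  "period z = (if \<exists>p\<ge>1. (T ^^ p) z = z
               then enat (LEAST p. 1 \<le> p \<and> (T ^^ p) z = z) else \<infinity>)"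

definition aperiodic :: "(int \<Rightarrow> 'a) \<Rightarrow> bool" where
  "aperiodic s \<longleftrightarrow> \<not> (\<exists>p\<ge>1. \<forall>k. s (k + p) = s k)"

lemma T_inverse:
  assumes "z \<in> unit_square"
  shows "T (frac (- snd z - sqrt 2 * fst z), fst z) = z"
proof -
  obtain x y where z: "z = (x, y)" by force
  have y: "0 \<le> y" "y < 1" using assms by (auto simp: z unit_square_def)
  have "- frac (- y - sqrt 2 * x) - sqrt 2 * x = y + of_int \<lfloor>- y - sqrt 2 * x\<rfloor>"
    by (simp add: frac_def)
  then have "frac (- frac (- y - sqrt 2 * x) - sqrt 2 * x) = y"
    using y by (simp add: frac_eq frac_unique_iff)
  then show ?thesis by (simp add: z T_def)
qed

lemma T_mem: "z \<in> unit_square \<Longrightarrow> T z \<in> unit_square"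
  by (auto simp: T_def unit_square_def frac_lt_1)

lemma inj_on_T: "inj_on T unit_square"
proof (rule inj_onI)
  fix z w assume zw: "z \<in> unit_square" "w \<in> unit_square" "T z = T w"
  obtain x y where z: "z = (x, y)" by force
  obtain x' y' where w: "w = (x', y')" by force
  have y: "y' = y" and f: "frac (- x - sqrt 2 * y) = frac (- x' - sqrt 2 * y)"
    using zw(3) by (auto simp: z w T_def)
  have "x' - x = of_int (\<lfloor>- x - sqrt 2 * y\<rfloor> - \<lfloor>- x' - sqrt 2 * y\<rfloor>)"
    using f by (simp add: frac_def)
  then obtain m :: int where m: "x' - x = of_int m" by blast
  moreover have "\<bar>x' - x\<bar> < 1" using zw by (auto simp: z w unit_square_def)
  ultimately have "m = 0" by linarith
  then show "z = w" using m y by (simp add: z w)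
qed

lemma bij_betw_T: "bij_betw T unit_square unit_square"
  unfolding bij_betw_def
proof (intro conjI inj_on_T equalityI subsetI)
  fix z assume "z \<in> T ` unit_square"
  then show "z \<in> unit_square" using T_mem by blast
next
  fix z assume z: "z \<in> unit_square"
  then have "(frac (- snd z - sqrt 2 * fst z), fst z) \<in> unit_square"
    by (auto simp: unit_square_def frac_lt_1)
  then show "z \<in> T ` unit_square" using T_inverse[OF z] by (metis imageI)
qed

lemma T_pow_mem:
  assumes "z \<in> unit_square" shows "T_pow k z \<in> unit_square"
proof -
  have "(T ^^ n) z \<in> unit_square" for n
    by (induction n) (auto simp: assms T_mem)
  moreover have "(inv_into unit_square T ^^ n) z \<in> unit_square" for n
    by (induction n) (use assms bij_betw_inv_into[OF bij_betw_T] bij_betwE in auto)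
  ultimately show ?thesis by (simp add: T_pow_def)
qed

lemma T_pow_Suc:
  assumes "z \<in> unit_square" shows "T_pow (k + 1) z = T (T_pow k z)"
proof (cases "0 \<le> k")
  case True
  then have "nat (k + 1) = Suc (nat k)" by simp
  then show ?thesis using True by (simp add: T_pow_def)
next
  case False
  define n where "n = nat (- k) - 1"
  have k: "k = - int (Suc n)" using False by (simp add: n_def)
  have eq: "T_pow (- int m) z = (inv_into unit_square T ^^ m) z" for m
    by (cases "m = 0") (simp_all add: T_pow_def)
  have "T_pow (- int n) z \<in> unit_square" by (rule T_pow_mem[OF assms])
  then have "T (inv_into unit_square T (T_pow (- int n) z)) = T_pow (- int n) z"
    by (rule bij_betw_inv_into_right[OF bij_betw_T])
  moreover have "k + 1 = - int n" using k by simp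
  ultimately show ?thesis using eq[of n] eq[of "Suc n"] k by simp
qed

lemma T_pow_add:
  assumes "z \<in> unit_square" shows "T_pow (k + int n) z = (T ^^ n) (T_pow k z)"
proof (induction n)
  case (Suc n)
  have "T_pow (k + int (Suc n)) z = T_pow ((k + int n) + 1) z" by (simp add: ac_simps)
  then show ?case using T_pow_Suc[OF assms] Suc by simp
qed simp

lemma aperiodic_iff_period:
  assumes z: "z \<in> unit_square"
  shows "aperiodic (\<lambda>k. T_pow k z) \<longleftrightarrow> period z = \<infinity>"
proof -
  have "(\<exists>p\<ge>1. \<forall>k. T_pow (k + p) z = T_pow k z) \<longleftrightarrow> (\<exists>p\<ge>1. (T ^^ p) z = z)"
  proof
    assume "\<exists>p\<ge>1. \<forall>k. T_pow (k + p) z = T_pow k z"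
    then obtain p :: int where "1 \<le> p" "T_pow (0 + p) z = T_pow 0 z" by blast
    then have "1 \<le> nat p" "(T ^^ nat p) z = z" by (auto simp: T_pow_def)
    then show "\<exists>p\<ge>1. (T ^^ p) z = z" by blast
  next
    assume "\<exists>p\<ge>1. (T ^^ p) z = z"
    then obtain p where p: "1 \<le> p" "(T ^^ p) z = z" by blast
    have per: "T_pow (k + int p) z = T_pow k z" for k
    proof (cases "0 \<le> k")
      case True
      have "T_pow (int p + int (nat k)) z = (T ^^ nat k) (T_pow (int p) z)"
        by (rule T_pow_add[OF z])
      then show ?thesis using True p by (simp add: T_pow_def add.commute)
    next
      case False
      have inj: "inj_on (T ^^ n) unit_square" for n
      proof (induction n)
        case (Suc n)
        have "(T ^^ n) ` unit_square \<subseteq> unit_square"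
          by (induction n) (auto simp: T_mem)
        then show ?case
          using comp_inj_on[OF Suc inj_on_subset[OF inj_on_T]] by (simp add: comp_def)
      qed simp
      have k: "k + int (nat (- k)) = 0" using False by simp
      have "(T ^^ nat (- k)) (T_pow (k + int p) z) = T_pow (k + int p + int (nat (- k))) z"
        by (rule T_pow_add[OF z, symmetric])
      also have "\<dots> = T_pow (int p) z" using False by (simp add: ac_simps)
      also have "\<dots> = z" using p by (simp add: T_pow_def)
      also have "\<dots> = T_pow (k + int (nat (- k))) z" using k by (simp add: T_pow_def)
      also have "\<dots> = (T ^^ nat (- k)) (T_pow k z)" by (rule T_pow_add[OF z])
      finally show ?thesis by (rule inj_onD[OF inj]) (rule T_pow_mem[OF z])+
    qed
    show "\<exists>p\<ge>1. \<forall>k. T_pow (k + p) z = T_pow k z"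
      by (rule exI[of _ "int p"]) (use p per in auto)
  qed
  then show ?thesis unfolding aperiodic_def period_def by auto
qed

end

theory Submission
  imports Defs
begin

text \<open>Along an orbit, consecutive coordinates satisfy \<open>x + sqrt 2 * y + z = n\<close> with an integer \<open>n\<close>, the
letter of the step. A nonzero point of the square has letter 1, 2 or 3, and for a fixed letter \<open>T\<close>
is affine; its linear part \<open>(x, y) \<mapsto> (y, - x - sqrt 2 * y)\<close> preserves
\<open>x\<^sup>2 + sqrt 2 * x * y + y\<^sup>2\<close> and has order 8. So \<open>T\<close> rotates each of three polygons by
the same angle, and the whole difficulty lies in how the pieces are put together again.

An orbit that only uses the letters 1 and 2 is periodic (\<open>periodic_or_letter_3\<close>): a few words
cannot occur, and the remaining sequences of letters are eventually periodic with a rotation of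
finite order as the map of their period. Hence everything happens in the triangle of points with
letter 3. In the coordinates \<open>(u, v) = (1 - x, 1 - y)\<close> it is
\<open>u > 0, v > 0, u + sqrt 2 * v < sqrt 2 - 1\<close>, and \<open>T\<close> returns to it by a map with only two branches
and an exceptional edge between them (\<open>induced\<close>). This map is self-similar: the reflected
contraction \<open>shrink (u, v) = (k * v, k * u)\<close> with \<open>k = sqrt 2 - 1\<close> carries the triangle onto the
second piece (without the edge), and the image under \<open>shrink\<close> of an orbit is contained in an orbit
(\<open>induced_renormalized\<close>).

A point of the triangle stays in the first piece only if it is periodic; otherwise its orbit
enters the second piece or is caught in a finite cycle at the edge. A point in the second piece
can be magnified by the inverse of \<open>shrink\<close>. If its coordinates lie in \<open>Z_sqrt2\<close>, then so do those
of the magnified point, and their conjugates are multiplied by \<open>- k\<close>, while the steps before a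
magnification only rotate or reflect the conjugates about a fixed centre. So repeated
magnification makes the conjugates small, but no point of the triangle has small conjugates
(\<open>no_low_points\<close>). The process must therefore stop at a periodic point, and periodicity is passed
back through \<open>shrink\<close> and along orbits (\<open>conjugate_recurrent\<close>).

The second point is \<open>start\<close> in the coordinates \<open>(u, v)\<close>; it escapes this argument because its
coordinates have denominator 4. Four magnifications along its orbit lead back to the point itself.
Hence its orbit contains the images of the point under all powers of the contraction
\<open>shrink ^^ 4\<close>, so it is infinite.\<close>

section \<open>The map in terms of letters\<close>

lemma sqrt2_mult [simp]: "sqrt 2 * sqrt 2 = (2::real)" "sqrt 2 * (sqrt 2 * x) = 2 * (x::real)"
  by (simp_all add: mult.assoc[symmetric])

lemma sqrt2_bounds: "707 / 500 < sqrt (2::real)" "sqrt (2::real) < 283 / 200"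
  by (rule real_less_rsqrt real_less_lsqrt; simp add: power2_eq_square)+

lemma sqrt2_mono:
  fixes a b :: real
  shows "a \<le> b \<Longrightarrow> sqrt 2 * a \<le> sqrt 2 * b" "a < b \<Longrightarrow> sqrt 2 * a < sqrt 2 * b"
  by auto

text \<open>The integer \<open>n\<close> with \<open>x + sqrt 2 * y + z' = n\<close>, where \<open>T (x, y) = (y, z')\<close>; see \<open>T_letter\<close>.\<close>

definition letter :: "real \<times> real \<Rightarrow> int" where
  "letter z = \<lceil>fst z + sqrt 2 * snd z\<rceil>"

fun follows :: "int list \<Rightarrow> real \<times> real \<Rightarrow> bool" where
  "follows [] z \<longleftrightarrow> True"
| "follows (n # w) z \<longleftrightarrow> letter z = n \<and> follows w (T z)"

fun word_map :: "int list \<Rightarrow> real \<times> real \<Rightarrow> real \<times> real" where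
  "word_map [] z = z"
| "word_map (n # w) z = word_map w (snd z, of_int n - fst z - sqrt 2 * snd z)"

lemma T_letter: "T z = (snd z, of_int (letter z) - fst z - sqrt 2 * snd z)"
proof (cases z)
  case (Pair x y)
  have "\<lfloor>- (x + sqrt 2 * y)\<rfloor> = - \<lceil>x + sqrt 2 * y\<rceil>" by (simp add: ceiling_def)
  then show ?thesis by (simp add: Pair T_def letter_def frac_def)
qed

lemma follows_iterate:
  assumes "follows w z" shows "(T ^^ length w) z = word_map w z"
  using assms
proof (induction w arbitrary: z)
  case (Cons n w)
  then have "(T ^^ length w) (T z) = word_map w (T z)" "letter z = n" by auto
  then show ?case by (simp add: funpow_Suc_right T_letter[of z] del: funpow.simps(2))
qed simp

text \<open>Rewriting with this lemma turns the condition that a symbolic point has a given itinerary into a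
conjunction of linear inequalities.\<close>

lemma follows_pair:
  "follows (n # w) (x, y) \<longleftrightarrow> of_int n - 1 < x + sqrt 2 * y \<and> x + sqrt 2 * y \<le> of_int n
     \<and> follows w (y, of_int n - x - sqrt 2 * y)"
proof -
  have "letter (x, y) = n \<longleftrightarrow> of_int n - 1 < x + sqrt 2 * y \<and> x + sqrt 2 * y \<le> of_int n"
    by (simp add: letter_def ceiling_eq_iff)
  moreover have "T (x, y) = (y, of_int n - x - sqrt 2 * y)" if "letter (x, y) = n"
    using that by (simp add: T_letter)
  ultimately show ?thesis by auto
qed

declare follows.simps(2) [simp del]

lemma funpow_T_mem: "z \<in> unit_square \<Longrightarrow> (T ^^ k) z \<in> unit_square"
  by (induction k) (auto simp: T_mem)

definition periodic :: "real \<times> real \<Rightarrow> bool" where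
  "periodic z \<longleftrightarrow> (\<exists>p\<ge>1. (T ^^ p) z = z)"

lemma periodicI: "(T ^^ p) z = z \<Longrightarrow> p \<ge> 1 \<Longrightarrow> periodic z"
  unfolding periodic_def by blast

lemma funpow_T_add: "(T ^^ (m + n)) z = (T ^^ m) ((T ^^ n) z)"
  by (simp add: funpow_add)

lemma funpow_T_inj:
  assumes "z \<in> unit_square" "w \<in> unit_square" "(T ^^ k) z = (T ^^ k) w" shows "z = w"
  using assms(3)
proof (induction k)
  case (Suc k)
  then show ?case
    using inj_onD[OF inj_on_T _ funpow_T_mem[OF assms(1)] funpow_T_mem[OF assms(2)]] by auto
qed simp

text \<open>\<open>T\<close> is injective on the square, so an orbit cannot enter a cycle from outside.\<close>

lemma periodic_backwards:
  assumes "z \<in> unit_square" "periodic ((T ^^ k) z)" shows "periodic z"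
proof -
  obtain p where p: "p \<ge> 1" "(T ^^ p) ((T ^^ k) z) = (T ^^ k) z" using assms(2) periodic_def by auto
  then have "(T ^^ k) ((T ^^ p) z) = (T ^^ k) z"
    by (metis add.commute funpow_T_add)
  then have "(T ^^ p) z = z" using funpow_T_inj[OF funpow_T_mem[OF assms(1)] assms(1)] by blast
  then show ?thesis using p(1) periodic_def by blast
qed

section \<open>Orbits that never use the letter 3\<close>

definition coord :: "real \<times> real \<Rightarrow> nat \<Rightarrow> real" where
  "coord z k = fst ((T ^^ k) z)"

definition code :: "real \<times> real \<Rightarrow> nat \<Rightarrow> int" where
  "code z k = letter ((T ^^ k) z)"

lemma funpow_T_coord: "(T ^^ k) z = (coord z k, coord z (Suc k))"
  by (simp add: coord_def prod_eq_iff T_letter[of "(T ^^ k) z"])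

lemma orbit_shift: "coord ((T ^^ k) z) i = coord z (k + i)" "code ((T ^^ k) z) i = code z (k + i)"
  by (simp_all add: coord_def code_def funpow_add[symmetric] add.commute flip: comp_apply[of "T ^^ _"])

lemma orbit_shift_T: "coord (T z) i = coord z (Suc i)" "code (T z) i = code z (Suc i)"
  using orbit_shift[where k = 1] by simp_all

lemma coord_rec: "coord z (Suc (Suc k)) = code z k - coord z k - sqrt 2 * coord z (Suc k)"
proof -
  have "T ((T ^^ k) z) = (coord z (Suc k), code z k - coord z k - sqrt 2 * coord z (Suc k))"
    by (subst T_letter) (simp add: code_def funpow_T_coord)
  then show ?thesis using funpow_T_coord[of "Suc k" z] by simp
qed

lemma coord_recs:
  "coord z 2 = code z 0 - coord z 0 - sqrt 2 * coord z 1"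
  "coord z 3 = code z 1 - coord z 1 - sqrt 2 * coord z 2"
  "coord z 4 = code z 2 - coord z 2 - sqrt 2 * coord z 3"
  "coord z 5 = code z 3 - coord z 3 - sqrt 2 * coord z 4"
  "coord z 6 = code z 4 - coord z 4 - sqrt 2 * coord z 5"
  "coord z 7 = code z 5 - coord z 5 - sqrt 2 * coord z 6"
  "coord z 8 = code z 6 - coord z 6 - sqrt 2 * coord z 7"
  "coord z 9 = code z 7 - coord z 7 - sqrt 2 * coord z 8"
  by (simp_all add: numeral_eq_Suc coord_rec)

text \<open>The linear part of \<open>T\<close> has order 8 and its fourth power is \<open>- 1\<close>. So any three coordinates in an
orbit satisfy a linear relation with coefficients 0, \<open>\<plusminus> 1\<close> and \<open>\<plusminus> sqrt 2\<close>
whose constant term is determined by the letters between them. A word is impossible as soon as one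
such relation contradicts the fact that the coordinates lie in \<open>{0..<1}\<close>; the following relations
suffice for all words that are needed.\<close>

lemma four_steps: "coord z 4 = code z 2 - sqrt 2 * code z 1 + code z 0 - coord z 0"
  by (simp add: coord_recs algebra_simps)

lemma six_steps:
  "coord z 6 + coord z 0 = sqrt 2 * coord z 3 + code z 4
     - sqrt 2 * code z 3 + code z 2 - sqrt 2 * code z 1 + code z 0"
  by (simp add: coord_recs algebra_simps)

lemma seven_steps:
  "coord z 7 = code z 5 - sqrt 2 * code z 4 + code z 3
     - code z 1 + sqrt 2 * code z 0 - sqrt 2 * coord z 0 - coord z 1"
  by (simp add: coord_recs algebra_simps)

lemma seven_steps':
  "coord z 2 = coord z 0 + sqrt 2 * (coord z 7 - code z 5 - code z 3 + code z 1)
     + 2 * code z 4 - code z 0"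
  by (simp add: coord_recs algebra_simps)

lemma eight_steps:
  "coord z 8 = coord z 0 + code z 6 - sqrt 2 * code z 5 + code z 4
     - code z 2 + sqrt 2 * code z 1 - code z 0"
  "coord z 9 = coord z 1 + code z 7 - sqrt 2 * code z 6 + code z 5
     - code z 3 + sqrt 2 * code z 2 - code z 1"
  by (simp_all add: coord_recs algebra_simps)

lemma coord_range:
  assumes "z \<in> unit_square" shows "0 \<le> coord z k" "coord z k < 1"
  using funpow_T_mem[OF assms, of k] by (auto simp: coord_def unit_square_def)

context
  fixes z :: "real \<times> real"
  assumes z: "z \<in> unit_square"
begin

text \<open>The name of each lemma is a word that it excludes. Together they leave only two continuations of a
change from 1 to 2. A letter whose coefficient in the relation vanishes does not appear in the
statement, so that some lemmas exclude a second word as well.\<close>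

lemma no_121: "\<not> (code z 0 = 1 \<and> code z 1 = 2 \<and> code z 2 = 1)"
  using four_steps[of z] coord_range[OF z, of 0] coord_range[OF z, of 4] sqrt2_bounds by auto

lemma no_212: "\<not> (code z 0 = 2 \<and> code z 1 = 1 \<and> code z 2 = 2)"
  using four_steps[of z] coord_range[OF z, of 0] coord_range[OF z, of 4] sqrt2_bounds by auto

lemma no_12221: "\<not> (code z 0 = 1 \<and> code z 1 = 2 \<and> code z 2 = 2 \<and> code z 3 = 2 \<and> code z 4 = 1)"
proof
  assume "code z 0 = 1 \<and> code z 1 = 2 \<and> code z 2 = 2 \<and> code z 3 = 2 \<and> code z 4 = 1"
  then have "coord z 6 + coord z 0 = sqrt 2 * coord z 3 + 4 - 4 * sqrt 2" using six_steps[of z] by simp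
  then show False using coord_range[OF z, of 0] coord_range[OF z, of 6]
    sqrt2_mono(2)[OF coord_range(2)[OF z, of 3]] sqrt2_bounds by linarith
qed

lemma no_21112: "\<not> (code z 0 = 2 \<and> code z 1 = 1 \<and> code z 2 = 1 \<and> code z 3 = 1 \<and> code z 4 = 2)"
proof
  assume "code z 0 = 2 \<and> code z 1 = 1 \<and> code z 2 = 1 \<and> code z 3 = 1 \<and> code z 4 = 2"
  then have "coord z 6 + coord z 0 = sqrt 2 * coord z 3 + 5 - 2 * sqrt 2" using six_steps[of z] by simp
  then show False using coord_range[OF z, of 0] coord_range[OF z, of 6]
    sqrt2_mono(1)[OF coord_range(1)[OF z, of 3]] sqrt2_bounds by linarith
qed

lemma no_122221: "\<not> (code z 0 = 1 \<and> code z 1 = 2 \<and> code z 3 = 2 \<and> code z 4 = 2 \<and> code z 5 = 1)"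
proof
  assume "code z 0 = 1 \<and> code z 1 = 2 \<and> code z 3 = 2 \<and> code z 4 = 2 \<and> code z 5 = 1"
  then have "coord z 7 = 1 - sqrt 2 - sqrt 2 * coord z 0 - coord z 1" using seven_steps[of z] by simp
  then show False using coord_range[OF z, of 1] coord_range[OF z, of 7]
    sqrt2_mono(1)[OF coord_range(1)[OF z, of 0]] sqrt2_bounds by linarith
qed

lemma no_122111: "\<not> (code z 0 = 1 \<and> code z 1 = 2 \<and> code z 3 = 1 \<and> code z 4 = 1 \<and> code z 5 = 1)"
proof
  assume "code z 0 = 1 \<and> code z 1 = 2 \<and> code z 3 = 1 \<and> code z 4 = 1 \<and> code z 5 = 1"
  then have "coord z 2 = coord z 0 + sqrt 2 * coord z 7 + 1" using seven_steps'[of z] by simp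
  then show False using coord_range[OF z, of 0] coord_range[OF z, of 2]
    sqrt2_mono(1)[OF coord_range(1)[OF z, of 7]] by linarith
qed

lemma no_211112: "\<not> (code z 0 = 2 \<and> code z 1 = 1 \<and> code z 3 = 1 \<and> code z 4 = 1 \<and> code z 5 = 2)"
proof
  assume "code z 0 = 2 \<and> code z 1 = 1 \<and> code z 3 = 1 \<and> code z 4 = 1 \<and> code z 5 = 2"
  then have "coord z 2 = coord z 0 + sqrt 2 * coord z 7 - 2 * sqrt 2"
    using seven_steps'[of z] by (simp add: algebra_simps)
  then show False using coord_range[OF z, of 0] coord_range[OF z, of 2]
    sqrt2_mono(2)[OF coord_range(2)[OF z, of 7]] sqrt2_bounds by linarith
qed

lemma no_1222222: "\<not> (code z 0 = 1 \<and> code z 1 = 2 \<and> code z 2 = 2 \<and> code z 4 = 2 \<and> code z 5 = 2 \<and> code z 6 = 2)"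
  and no_2211222: "\<not> (code z 0 = 2 \<and> code z 1 = 2 \<and> code z 2 = 1 \<and> code z 4 = 2 \<and> code z 5 = 2 \<and> code z 6 = 2)"
  and no_2221122: "\<not> (code z 0 = 2 \<and> code z 1 = 2 \<and> code z 2 = 2 \<and> code z 4 = 1 \<and> code z 5 = 2 \<and> code z 6 = 2)"
  and no_2111111: "\<not> (code z 0 = 2 \<and> code z 1 = 1 \<and> code z 2 = 1 \<and> code z 4 = 1 \<and> code z 5 = 1 \<and> code z 6 = 1)"
  using eight_steps(1)[of z] coord_range[OF z, of 0] coord_range[OF z, of 8] by auto

end

text \<open>The hypotheses say that the constant terms in both relations of \<open>eight_steps\<close> vanish.\<close>

lemma period_8:
  assumes "code z 4 + code z 6 = code z 0 + code z 2" "code z 5 = code z 1"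
    "code z 5 + code z 7 = code z 1 + code z 3" "code z 6 = code z 2"
  shows "(T ^^ 8) z = z"
proof -
  have "real_of_int (code z 4 + code z 6) = real_of_int (code z 0 + code z 2)" using assms by simp
  then have "coord z 8 = coord z 0" using eight_steps(1)[of z] assms by simp
  moreover
  have "real_of_int (code z 5 + code z 7) = real_of_int (code z 1 + code z 3)" using assms by simp
  then have "coord z 9 = coord z 1" using eight_steps(2)[of z] assms by simp
  ultimately show ?thesis using funpow_T_coord[of 8 z] funpow_T_coord[of 0 z] by simp
qed

lemma follows_code: "follows (n # w) z \<longleftrightarrow> code z 0 = n \<and> follows w (T z)"
  by (simp add: follows.simps(2) code_def)

text \<open>At a change from 1 to 2, the runs that follow either have length two, which closes up after 8
steps, or have length five, and then the same change occurs again 10 steps later. The word of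
length 10 begins with the last 1 before the change and therefore ends with only four of the next
five 1s.\<close>

lemma run_dichotomy:
  assumes z: "z \<in> unit_square"
    and letters: "\<And>i. code z i = 1 \<or> code z i = 2" and sw: "code z 0 = 1" "code z 1 = 2"
  shows "(T ^^ 8) z = z \<or> follows [1,2,2,2,2,2,1,1,1,1] z \<and> code z 10 = 1 \<and> code z 11 = 2"
proof -
  note at = funpow_T_mem[OF z] and shift = orbit_shift orbit_shift_T numeral_eq_Suc
  have c2: "code z 2 = 2" using no_121[OF z] letters[of 2] sw by auto
  show ?thesis
  proof (cases "code z 3 = 1")
    case True
    then have c4: "code z 4 = 1" using no_212[OF at, of 2] letters[of 4] c2
      by (auto simp: shift)
    then have c5: "code z 5 = 2" using no_122111[OF z] letters[of 5] True sw by auto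
    have c6: "code z 6 = 2" using no_121[OF at, of 4] letters[of 6] c4 c5
      by (auto simp: shift)
    have "code z 7 = 1" using no_2211222[OF at, of 1] letters[of 7] sw c2 True c5 c6
      by (auto simp: shift)
    then show ?thesis using period_8[of z] sw True c2 c4 c5 c6 by simp
  next
    case False
    then have c3: "code z 3 = 2" using letters[of 3] by auto
    have c4: "code z 4 = 2" using no_12221[OF z] letters[of 4] c2 c3 sw by auto
    have c5: "code z 5 = 2" using no_122221[OF z] letters[of 5] c3 c4 sw by auto
    have c6: "code z 6 = 1" using no_1222222[OF z] letters[of 6] c2 c4 c5 sw by auto
    have c7: "code z 7 = 1" using no_212[OF at, of 5] letters[of 7] c5 c6
      by (auto simp: shift)
    have c8: "code z 8 = 1"
      using no_121[OF at, of 7] no_2221122[OF at, of 3] letters[of 8] letters[of 9] c3 c4 c5 c7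
      by (auto simp: shift)
    have c9: "code z 9 = 1" using no_21112[OF at, of 5] letters[of 9] c5 c6 c7 c8
      by (auto simp: shift)
    have c10: "code z 10 = 1" using no_211112[OF at, of 5] letters[of 10] c5 c6 c8 c9
      by (auto simp: shift)
    have "code z 11 = 2" using no_2111111[OF at, of 5] letters[of 11] c5 c6 c7 c9 c10
      by (auto simp: shift)
    then show ?thesis using sw c2 c3 c4 c5 c6 c7 c8 c9 c10
      by (simp add: follows_code orbit_shift_T numeral_eq_Suc)
  qed
qed

lemma letter_cases:
  assumes "z \<in> unit_square"
  shows "z = (0, 0) \<or> letter z = 1 \<or> letter z = 2 \<or> 2 < fst z + sqrt 2 * snd z"
proof (cases "z = (0, 0)")
  case False
  obtain x y where z: "z = (x, y)" by force
  have b: "0 \<le> x" "0 \<le> y" using assms by (auto simp: z unit_square_def)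
  then have "0 < x \<or> 0 < y" using False by (auto simp: z)
  then have "0 < x + sqrt 2 * y" using b by (auto intro: add_pos_nonneg add_nonneg_pos)
  then show ?thesis by (auto simp: z letter_def ceiling_eq_iff)
qed simp

text \<open>The linear part of \<open>T\<close> is a rotation of order 8, so its tenth power has order 4.\<close>

lemma word_map_five_fives:
  fixes z defines "g \<equiv> word_map [1,2,2,2,2,2,1,1,1,1]"
  shows "g (g (g (g z))) = z"
  unfolding g_def by (cases z) (simp add: algebra_simps)

lemma switch_periodic:
  assumes "z \<in> unit_square" "\<And>i. code z i = 1 \<or> code z i = 2" "code z 0 = 1" "code z 1 = 2"
  shows "periodic z"
proof (rule ccontr)
  assume np: "\<not> periodic z"
  define w :: "int list" where "w = [1,2,2,2,2,2,1,1,1,1]"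
  have sw: "follows w ((T ^^ (10 * j)) z) \<and> code z (10 * j + 10) = 1 \<and> code z (10 * j + 11) = 2" for j
  proof (induction j)
    case 0
    have "\<not> (T ^^ 8) z = z" using np periodicI[of 8 z] by auto
    then show ?case using run_dichotomy[OF assms] by (simp add: w_def)
  next
    case (Suc j)
    let ?y = "(T ^^ (10 * Suc j)) z"
    have "\<not> periodic ?y" using np periodic_backwards[OF assms(1)] by blast
    then have ne: "(T ^^ 8) ?y \<noteq> ?y" using periodicI[of 8 ?y] by auto
    have "code ?y 0 = 1" "code ?y 1 = 2" "\<And>i. code ?y i = 1 \<or> code ?y i = 2"
      using Suc assms(2) unfolding orbit_shift by (simp_all add: ac_simps)
    then have "follows w ?y \<and> code ?y 10 = 1 \<and> code ?y 11 = 2"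
      using run_dichotomy[OF funpow_T_mem[OF assms(1)]] ne unfolding w_def by blast
    then show ?case unfolding orbit_shift by blast
  qed
  have len: "length w = 10" by (simp add: w_def)
  have step: "(T ^^ (10 * Suc j)) z = word_map w ((T ^^ (10 * j)) z)" for j
  proof -
    have "(T ^^ 10) ((T ^^ (10 * j)) z) = word_map w ((T ^^ (10 * j)) z)"
      using follows_iterate[of w] sw[of j] len by metis
    then show ?thesis unfolding mult_Suc_right funpow_T_add .
  qed
  have "(T ^^ 40) z = z"
    using step[of 0] step[of 1] step[of 2] step[of 3] word_map_five_fives[of z, folded w_def]
    by simp
  then show False using np periodicI[of 40 z] by simp
qed

lemma constant_code_periodic:
  assumes "\<And>i. code z i = n" shows "periodic z"
proof -
  have "(T ^^ 8) z = z" by (rule period_8) (simp_all add: assms)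
  then show ?thesis by (rule periodicI) simp
qed

lemma periodic_or_letter_3:
  assumes z: "z \<in> unit_square"
  shows "periodic z \<or> (\<exists>k. 2 < fst ((T ^^ k) z) + sqrt 2 * snd ((T ^^ k) z))"
proof (rule ccontr)
  assume contra: "\<not> ?thesis"
  have np: "\<not> periodic ((T ^^ k) z)" for k using contra periodic_backwards[OF z] by blast
  have "(T ^^ k) z \<noteq> (0, 0)" for k
  proof
    assume "(T ^^ k) z = (0, 0)"
    then have "(T ^^ 1) ((T ^^ k) z) = (T ^^ k) z" by (simp add: T_def)
    then show False using np[of k] unfolding periodic_def by blast
  qed
  then have letters: "code z k = 1 \<or> code z k = 2" for k
    using letter_cases[OF funpow_T_mem[OF z, of k]] contra unfolding code_def by blast
  have no_switch: "code z (Suc k) = 1" if "code z k = 1" for k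
  proof (rule ccontr)
    assume "code z (Suc k) \<noteq> 1"
    then have "code z (Suc k) = 2" using letters by blast
    then have "periodic ((T ^^ k) z)"
      using that letters by (intro switch_periodic funpow_T_mem z) (auto simp: orbit_shift)
    then show False using np by blast
  qed
  show False
  proof (cases "\<exists>k. code z k = 1")
    case True
    then obtain k where "code z k = 1" by blast
    then have "code z (k + i) = 1" for i by (induction i) (auto intro: no_switch)
    then have "periodic ((T ^^ k) z)" by (intro constant_code_periodic[of _ 1]) (simp add: orbit_shift)
    then show False using np by blast
  next
    case False
    then have "periodic z" using letters by (intro constant_code_periodic[of _ 2]) auto
    then show False using contra by blast
  qed
qed

section \<open>The return map of the corner triangle\<close>

text \<open>Return words are easier to follow in coordinates measured from the corner \<open>(1, 1)\<close>, where the
triangle becomes a linear condition on two positive numbers. The map is an involution.\<close>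

definition corner :: "real \<times> real \<Rightarrow> real \<times> real" where
  "corner p = (1 - fst p, 1 - snd p)"

text \<open>The common initial part of the two long returns to the triangle. The open piece continues with the
letter 2 and is back after 22 steps. On its edge the letter 2 would produce the coordinate 1; so
the letter is 1, the coordinate is 0, and the point takes ten further steps.\<close>

definition branch_word where "branch_word = [3,2,1,1,2,2,2,2,2,1,1,1,1,1,2,2,2,2,2,1,1::int]"

lemma follows_branch_word:
  assumes "0 < u" "0 < v" "sqrt 2 * u + v \<le> 3 - 2 * sqrt 2"
  shows "follows branch_word (corner (u, v))"
proof -
  have bounds: "0 < u * sqrt 2" "0 < v * sqrt 2" "u * sqrt 2 + v \<le> 3 - 2 * sqrt 2"
    "2 * u + v * sqrt 2 \<le> 3 * sqrt 2 - 4"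
    using assms sqrt2_mono(1)[OF assms(3)] by (auto simp: algebra_simps)
  show ?thesis
    unfolding branch_word_def corner_def
    by (simp add: follows_pair algebra_simps)
      (intro conjI; use assms(1,2) bounds sqrt2_bounds in linarith)
qed

lemma word_map_branch_word: "word_map branch_word (corner (u, v)) = (v, 2 * sqrt 2 - 2 - u - sqrt 2 * v)"
  unfolding branch_word_def corner_def by (simp add: algebra_simps)

lemma follows_edge_word:
  assumes "0 < u" "0 < v" "sqrt 2 * u + v = 3 - 2 * sqrt 2"
  shows "follows [1,1,1,2,2,2,2,2,1,1,2::int] (v, 2 * sqrt 2 - 2 - u - sqrt 2 * v)"
proof -
  have v: "v = 3 - 2 * sqrt 2 - u * sqrt 2" using assms by (simp add: algebra_simps)
  have bounds: "0 < u * sqrt 2" "0 < 3 - 2 * sqrt 2 - u * sqrt 2" "0 < 3 * sqrt 2 - 4 - 2 * u"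
    using assms(1,2) mult_strict_right_mono[of 0 v "sqrt 2"] by (auto simp: v algebra_simps)
  show ?thesis unfolding v
    by (simp add: follows_pair algebra_simps)
      (intro conjI; use assms(1) bounds sqrt2_bounds in linarith)
qed

definition triangle :: "(real \<times> real) set" where
  "triangle = {p. 0 < fst p \<and> 0 < snd p \<and> fst p + sqrt 2 * snd p < sqrt 2 - 1}"

text \<open>The three cases take 1, 32 and 22 steps of \<open>T\<close>. As the linear part of \<open>T\<close> has order 8, the second
one is a translation. The edge needs a branch of its own because its points are sent to the side
\<open>y = 1\<close> by the continuation of the third branch, and this side does not belong to the half-open
square.\<close>

definition induced :: "real \<times> real \<Rightarrow> real \<times> real" where
  "induced = (\<lambda>(u, v).
     if sqrt 2 * u + v > 3 - 2 * sqrt 2 then (v, sqrt 2 - 1 - u - sqrt 2 * v)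
     else if sqrt 2 * u + v = 3 - 2 * sqrt 2 then (u + (3 - 2 * sqrt 2), v)
     else (3 - 2 * sqrt 2 + u + sqrt 2 * v, 3 - 2 * sqrt 2 - sqrt 2 * u - v))"

lemma induced_simps:
  "sqrt 2 * u + v > 3 - 2 * sqrt 2 \<Longrightarrow> induced (u, v) = (v, sqrt 2 - 1 - u - sqrt 2 * v)"
  "sqrt 2 * u + v = 3 - 2 * sqrt 2 \<Longrightarrow> induced (u, v) = (u + (3 - 2 * sqrt 2), v)"
  "sqrt 2 * u + v < 3 - 2 * sqrt 2 \<Longrightarrow>
    induced (u, v) = (3 - 2 * sqrt 2 + u + sqrt 2 * v, 3 - 2 * sqrt 2 - sqrt 2 * u - v)"
  by (simp_all add: induced_def)

lemma triangle_iff: "(u, v) \<in> triangle \<longleftrightarrow> 0 < u \<and> 0 < v \<and> u + sqrt 2 * v < sqrt 2 - 1"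
  by (simp add: triangle_def)

lemma corner_triangle:
  assumes "p \<in> triangle" shows "corner p \<in> unit_square"
proof -
  obtain u v where p: "p = (u, v)" by force
  have uv: "0 < u" "0 < v" "u + sqrt 2 * v < sqrt 2 - 1" using assms by (auto simp: p triangle_iff)
  moreover have "0 < sqrt 2 * v" using uv by simp
  moreover have "v \<le> sqrt 2 * v" using uv sqrt2_bounds by simp
  ultimately have "u < 1" "v < 1" using sqrt2_bounds by linarith+
  then show ?thesis using uv by (auto simp: p corner_def unit_square_def)
qed

lemma induced_triangle:
  assumes "p \<in> triangle" shows "induced p \<in> triangle"
proof -
  obtain u v where p: "p = (u, v)" by force
  have uv: "0 < u" "0 < v" "u + sqrt 2 * v < sqrt 2 - 1" using assms by (auto simp: p triangle_iff)
  have pos: "0 < u * sqrt 2" "0 < v * sqrt 2" using uv by auto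
  show ?thesis
  proof (cases "sqrt 2 * u + v" "3 - 2 * sqrt 2" rule: linorder_cases)
    case less
    then show ?thesis
      by (simp add: p induced_simps triangle_iff algebra_simps) (use uv pos sqrt2_bounds in linarith)
  next
    case equal
    then have "2 * u + sqrt 2 * v = 3 * sqrt 2 - 4" using arg_cong[OF equal, of "\<lambda>t. sqrt 2 * t"]
      by (simp add: algebra_simps)
    then show ?thesis using uv pos equal sqrt2_bounds by (simp add: p induced_simps triangle_iff)
  next
    case greater
    then have "2 * u + v * sqrt 2 > 3 * sqrt 2 - 4" using sqrt2_mono(2)[OF greater]
      by (simp add: algebra_simps)
    then show ?thesis using uv greater sqrt2_bounds by (simp add: p induced_simps triangle_iff algebra_simps)
  qed
qed

lemma induced_reached:
  assumes "p \<in> triangle" shows "\<exists>n\<ge>1. (T ^^ n) (corner p) = corner (induced p)"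
proof -
  obtain u v where p: "p = (u, v)" by force
  have uv: "0 < u" "0 < v" "u + sqrt 2 * v < sqrt 2 - 1" using assms by (auto simp: p triangle_iff)
  have pos: "0 < u * sqrt 2" "0 < v * sqrt 2" "u + v * sqrt 2 < sqrt 2 - 1"
    using uv by (auto simp: mult.commute)
  have iter: "\<exists>n\<ge>1. (T ^^ n) z = y" if "follows w z" "word_map w z = y" "w \<noteq> []" for w z y
    using follows_iterate[OF that(1)] that(2,3) by (intro exI[of _ "length w"]) (auto simp: Suc_le_eq)
  have append: "follows (w @ w') z \<longleftrightarrow> follows w z \<and> follows w' (word_map w z)"
    "word_map (w @ w') z = word_map w' (word_map w z)" for w w' z
    by (induction w arbitrary: z) (auto simp: follows.simps(2) T_letter)
  note word_map = word_map_branch_word[unfolded corner_def fst_conv snd_conv]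
  show ?thesis
  proof (cases "sqrt 2 * u + v" "3 - 2 * sqrt 2" rule: linorder_cases)
    case less
    have "follows (branch_word @ [2]) (corner (u, v))"
      unfolding append word_map_branch_word using follows_branch_word[OF uv(1,2)] less
      by (simp add: follows_pair algebra_simps) (use pos uv sqrt2_bounds in linarith)
    then show ?thesis unfolding p
      by (rule iter)
        (use less in \<open>simp_all add: append word_map p induced_simps corner_def algebra_simps\<close>)
  next
    case equal
    have v: "v = 3 - 2 * sqrt 2 - sqrt 2 * u" using equal by linarith
    have "follows (branch_word @ [1,1,1,2,2,2,2,2,1,1,2]) (corner (u, v))"
      unfolding append word_map_branch_word using follows_branch_word[OF uv(1,2)] follows_edge_word[OF uv(1,2) equal] equal
      by simp
    then show ?thesis unfolding p
      by (rule iter)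
        (use equal in \<open>simp_all add: append word_map induced_simps corner_def\<close>,
         simp_all add: v algebra_simps)
  next
    case greater
    have "follows [3] (corner (u, v))"
      unfolding corner_def
      by (simp add: follows_pair algebra_simps) (intro conjI; use uv pos sqrt2_bounds in linarith)
    then show ?thesis unfolding p
      by (rule iter)
        (use greater in \<open>simp_all add: p induced_simps corner_def algebra_simps\<close>)
  qed
qed

section \<open>Renormalization\<close>

text \<open>The second piece of \<open>induced\<close> is the image of the triangle. Since a reflection turns a rotation
into its inverse, the exchange of the coordinates is what makes the two rotation angles match.\<close>

definition shrink :: "real \<times> real \<Rightarrow> real \<times> real" where
  "shrink p = ((sqrt 2 - 1) * snd p, (sqrt 2 - 1) * fst p)"

lemma shrink_triangle:
  assumes "p \<in> triangle" shows "shrink p \<in> triangle"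
proof -
  obtain u v where p: "p = (u, v)" by force
  have uv: "0 < u" "0 < v" "u + sqrt 2 * v < sqrt 2 - 1" using assms by (auto simp: p triangle_iff)
  have k: "0 < sqrt 2 - 1" "sqrt 2 - 1 < 1" using sqrt2_bounds by linarith+
  have "(sqrt 2 - 1) * (u + sqrt 2 * v) < (sqrt 2 - 1) * (sqrt 2 - 1)"
    using uv k by (intro mult_strict_left_mono) auto
  then have *: "sqrt 2 * ((sqrt 2 - 1) * v) + (sqrt 2 - 1) * u < 3 - 2 * sqrt 2"
    by (simp add: algebra_simps)
  have "0 < (sqrt 2 - 1) * v" "0 < (sqrt 2 - 1) * u" using uv k by simp_all
  moreover have "(sqrt 2 - 1) * v + sqrt 2 * ((sqrt 2 - 1) * u) < sqrt 2 - 1"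
    using sqrt2_mono(2)[OF *] calculation sqrt2_bounds by (simp add: algebra_simps)
  ultimately show ?thesis by (simp add: p shrink_def triangle_iff)
qed

text \<open>The branches of \<open>induced\<close> in units of the scaling factor \<open>k\<close>, using \<open>k * k = 3 - 2 * sqrt 2\<close>.\<close>

lemma induced_scaled:
  fixes a b :: real
  defines "k \<equiv> sqrt 2 - 1"
  shows "k < sqrt 2 * a + b \<Longrightarrow> induced (k * a, k * b) = (k * b, k * (1 - a - sqrt 2 * b))"
    "sqrt 2 * a + b = k \<Longrightarrow> induced (k * a, k * b) = (k * (a + k), k * b)"
    "sqrt 2 * a + b < k \<Longrightarrow> induced (k * a, k * b) = (k * (k + a + sqrt 2 * b), k * (k - sqrt 2 * a - b))"
proof -
  have k: "0 < k" using sqrt2_bounds by (simp add: k_def)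
  have kk: "3 - 2 * sqrt 2 = k * k" by (simp add: k_def algebra_simps)
  have eq: "sqrt 2 * (k * a) + k * b = k * (sqrt 2 * a + b)" by (simp add: algebra_simps)
  show "induced (k * a, k * b) = (k * b, k * (1 - a - sqrt 2 * b))" if "k < sqrt 2 * a + b"
    using that k by (subst induced_simps(1)) (simp_all add: eq kk, simp add: k_def algebra_simps)
  show "induced (k * a, k * b) = (k * (a + k), k * b)" if "sqrt 2 * a + b = k"
    using that k by (subst induced_simps(2)) (simp_all add: eq kk, simp_all add: algebra_simps)
  show "induced (k * a, k * b) = (k * (k + a + sqrt 2 * b), k * (k - sqrt 2 * a - b))" if "sqrt 2 * a + b < k"
    using that k by (subst induced_simps(3)) (simp_all add: eq kk, simp_all add: algebra_simps)
qed

text \<open>The itinerary of \<open>shrink p\<close> depends only on the piece that contains \<open>p\<close>. It starts with one step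
in the second piece and one in the first; after this, no step, three steps in the first piece, or
one step on the edge and one in the first piece remain.\<close>

lemma induced_renormalized:
  assumes "p \<in> triangle" shows "\<exists>m\<ge>1. (induced ^^ m) (shrink p) = shrink (induced p)"
proof -
  define k :: real where "k = sqrt 2 - 1"
  note scaled = induced_scaled[folded k_def]
  have k: "0 < k" "k < 1/2" "sqrt 2 * k = 1 - k" "k * k = 1 - 2 * k"
    using sqrt2_bounds by (auto simp: k_def algebra_simps)
  obtain u v where p: "p = (u, v)" by force
  have uv: "0 < u" "0 < v" "u + sqrt 2 * v < k" using assms by (auto simp: p triangle_iff k_def)
  have pos: "0 < sqrt 2 * u" "0 < sqrt 2 * v" using uv by auto
  have kk: "3 - 2 * sqrt 2 = 1 - 2 * k" by (simp add: k_def)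
  have shrink: "shrink (a, b) = (k * b, k * a)" for a b by (simp add: shrink_def k_def)
  have lt: "sqrt 2 * v + u < k" using uv by simp
  have r1: "induced (shrink p) = (k * (k + v + sqrt 2 * u), k * (k - sqrt 2 * v - u))"
    unfolding p shrink using scaled(3)[OF lt] by simp
  have wide: "k < sqrt 2 * (k + v + sqrt 2 * u) + (k - sqrt 2 * v - u)"
    using uv k by (simp add: algebra_simps)
  have r2: "induced (induced (shrink p)) = (k * (k - sqrt 2 * v - u), k * v)"
    unfolding r1 scaled(1)[OF wide] by (simp add: k_def algebra_simps)
  show ?thesis
  proof (cases "sqrt 2 * u + v" "1 - 2 * k" rule: linorder_cases)
    case greater
    have "(induced ^^ 2) (shrink p) = induced (induced (shrink p))" by (simp add: numeral_2_eq_2)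
    also have "\<dots> = shrink (induced p)"
      unfolding r2 unfolding p using induced_simps(1)[of u v] greater by (simp add: shrink kk) (simp add: k_def)
    finally have "(induced ^^ 2) (shrink p) = shrink (induced p)" .
    then show ?thesis by (intro exI[of _ 2]) simp
  next
    case less
    have "k < sqrt 2 * (k - sqrt 2 * v - u) + v"
      using less k by (simp add: algebra_simps)
    then have r3: "induced (k * (k - sqrt 2 * v - u), k * v) = (k * v, k * (1 - k + u))"
      by (subst scaled(1)) (simp_all add: algebra_simps)
    have "k < sqrt 2 * v + (1 - k + u)" using uv k pos by linarith
    then have r4: "induced (k * v, k * (1 - k + u)) = (k * (1 - k + u), k * (1 - 2 * k - sqrt 2 * u - v))"
      by (subst scaled(1)) (simp_all add: algebra_simps k_def)
    have "sqrt 2 * (1 - k + u) + (1 - 2 * k - sqrt 2 * u - v) = 1 - v"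
      by (simp add: algebra_simps k_def)
    then have "k < sqrt 2 * (1 - k + u) + (1 - 2 * k - sqrt 2 * u - v)"
      using less pos k by linarith
    then have r5: "induced (k * (1 - k + u), k * (1 - 2 * k - sqrt 2 * u - v))
        = (k * (1 - 2 * k - sqrt 2 * u - v), k * (1 - 2 * k + u + sqrt 2 * v))"
      by (subst scaled(1)) (simp_all add: algebra_simps k_def)
    have "(induced ^^ 5) (shrink p) = induced (induced (induced (induced (induced (shrink p)))))" by (simp add: numeral_eq_Suc)
    also have "\<dots> = shrink (induced p)"
      unfolding r2 unfolding r3 r4 r5 p using induced_simps(3)[of u v] less by (simp add: shrink kk)
    finally have "(induced ^^ 5) (shrink p) = shrink (induced p)" .
    then show ?thesis by (intro exI[of _ 5]) simp
  next
    case equal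
    have "sqrt 2 * (k - sqrt 2 * v - u) + v = k"
      using equal k by (simp add: algebra_simps)
    then have r3: "induced (k * (k - sqrt 2 * v - u), k * v) = (k * (2 * k - sqrt 2 * v - u), k * v)"
      by (subst scaled(2)) (simp_all add: algebra_simps)
    have "k < sqrt 2 * (2 * k - sqrt 2 * v - u) + v"
      using equal k by (simp add: algebra_simps)
    then have r4: "induced (k * (2 * k - sqrt 2 * v - u), k * v) = (k * v, k * (1 - 2 * k + u))"
      by (subst scaled(1)) (simp_all add: algebra_simps)
    have "(induced ^^ 4) (shrink p) = induced (induced (induced (induced (shrink p))))" by (simp add: numeral_eq_Suc)
    also have "\<dots> = shrink (induced p)"
      unfolding r2 unfolding r3 r4 p using induced_simps(2)[of u v] equal by (simp add: shrink kk)
    finally have "(induced ^^ 4) (shrink p) = shrink (induced p)" .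
    then show ?thesis by (intro exI[of _ 4]) simp
  qed
qed

lemma funpow_induced_triangle: "p \<in> triangle \<Longrightarrow> (induced ^^ n) p \<in> triangle"
  by (induction n) (auto simp: induced_triangle)

lemma funpow_induced_reached:
  assumes "p \<in> triangle" shows "\<exists>m\<ge>n. (T ^^ m) (corner p) = corner ((induced ^^ n) p)"
proof (induction n)
  case (Suc n)
  then obtain m where m: "m \<ge> n" "(T ^^ m) (corner p) = corner ((induced ^^ n) p)" by blast
  obtain l where "l \<ge> 1" "(T ^^ l) (corner ((induced ^^ n) p)) = corner ((induced ^^ Suc n) p)"
    using induced_reached[OF funpow_induced_triangle[OF assms]] by auto
  then show ?case using m by (intro exI[of _ "l + m"]) (simp add: funpow_T_add)
qed (auto intro: exI[of _ 0])

lemma funpow_induced_renormalized: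
  assumes "p \<in> triangle" shows "\<exists>m\<ge>n. (induced ^^ m) (shrink p) = shrink ((induced ^^ n) p)"
proof (induction n)
  case (Suc n)
  then obtain m where m: "m \<ge> n" "(induced ^^ m) (shrink p) = shrink ((induced ^^ n) p)" by blast
  obtain l where "l \<ge> 1" "(induced ^^ l) (shrink ((induced ^^ n) p)) = shrink ((induced ^^ Suc n) p)"
    using induced_renormalized[OF funpow_induced_triangle[OF assms]] by auto
  then show ?case using m by (intro exI[of _ "l + m"]) (simp add: funpow_add)
qed (auto intro: exI[of _ 0])

text \<open>Eventual periodicity under \<open>induced\<close>: in this form the property passes directly to \<open>shrink p\<close> and
backwards along orbits. The injectivity of \<open>T\<close> turns it into periodicity at the end.\<close>

definition recurrent :: "real \<times> real \<Rightarrow> bool" where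
  "recurrent p \<longleftrightarrow> (\<exists>n m. m \<ge> 1 \<and> (induced ^^ m) ((induced ^^ n) p) = (induced ^^ n) p)"

lemma recurrentI: "(induced ^^ m) p = p \<Longrightarrow> m \<ge> 1 \<Longrightarrow> recurrent p"
  unfolding recurrent_def by (intro exI[of _ 0] exI[of _ m]) simp

lemma recurrent_backwards:
  assumes "recurrent ((induced ^^ k) p)" shows "recurrent p"
proof -
  obtain n m where "m \<ge> 1" "(induced ^^ m) ((induced ^^ n) ((induced ^^ k) p)) = (induced ^^ n) ((induced ^^ k) p)"
    using assms unfolding recurrent_def by blast
  then show ?thesis unfolding recurrent_def by (intro exI[of _ "n + k"] exI[of _ m]) (simp add: funpow_add)
qed

lemma recurrent_shrink:
  assumes p: "p \<in> triangle" and "recurrent p" shows "recurrent (shrink p)"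
proof -
  obtain n m where nm: "m \<ge> 1" "(induced ^^ m) ((induced ^^ n) p) = (induced ^^ n) p"
    using assms(2) unfolding recurrent_def by blast
  obtain a where a: "(induced ^^ a) (shrink p) = shrink ((induced ^^ n) p)"
    using funpow_induced_renormalized[OF p] by blast
  obtain b where b: "b \<ge> m" "(induced ^^ b) (shrink ((induced ^^ n) p)) = shrink ((induced ^^ n) p)"
    using funpow_induced_renormalized[OF funpow_induced_triangle[OF p], where n = m] nm(2) by metis
  then show ?thesis using nm(1) a recurrent_backwards[of a] recurrentI[of b "shrink ((induced ^^ n) p)"] by simp
qed

lemma recurrent_periodic:
  assumes p: "p \<in> triangle" and "recurrent p" shows "periodic (corner p)"
proof -
  obtain n m where nm: "m \<ge> 1" "(induced ^^ m) ((induced ^^ n) p) = (induced ^^ n) p"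
    using assms(2) unfolding recurrent_def by blast
  obtain a where a: "(T ^^ a) (corner p) = corner ((induced ^^ n) p)"
    using funpow_induced_reached[OF p] by blast
  obtain b where b: "b \<ge> m" "(T ^^ b) (corner ((induced ^^ n) p)) = corner ((induced ^^ n) p)"
    using funpow_induced_reached[OF funpow_induced_triangle[OF p], where n = m] nm(2) by metis
  then have "periodic ((T ^^ a) (corner p))" unfolding a by (intro periodicI[of b]) (use nm(1) in auto)
  then show ?thesis by (rule periodic_backwards[OF corner_triangle[OF p]])
qed

section \<open>Orbits in the first piece and on the edge\<close>

text \<open>On the first piece \<open>induced\<close> is a rotation of order 8.\<close>

lemma induced_eight:
  assumes "\<And>i. i < 8 \<Longrightarrow> 3 - 2 * sqrt 2 < sqrt 2 * fst ((induced ^^ i) p) + snd ((induced ^^ i) p)"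
  shows "(induced ^^ 8) p = p"
proof -
  have step: "(induced ^^ Suc i) p = (snd ((induced ^^ i) p), sqrt 2 - 1 - fst ((induced ^^ i) p) - sqrt 2 * snd ((induced ^^ i) p))"
    if "i < 8" for i
    using induced_simps(1)[of "fst ((induced ^^ i) p)" "snd ((induced ^^ i) p)"] assms[OF that] by simp
  show ?thesis
    using step[of 0] step[of 1] step[of 2] step[of 3] step[of 4] step[of 5] step[of 6] step[of 7]
    by (cases p) (simp add: numeral_eq_Suc algebra_simps)
qed

text \<open>The translation on the edge followed by a step in the first piece is the reflection in the
diagonal. This is why passing through the edge does not change the distance of the conjugates from
their centre.\<close>

lemma induced_twice_edge:
  assumes "(u, v) \<in> triangle" "sqrt 2 * u + v = 3 - 2 * sqrt 2"
  shows "(induced ^^ 2) (u, v) = (v, u)"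
proof -
  have v: "v = 3 - 2 * sqrt 2 - sqrt 2 * u" using assms by linarith
  have "3 - 2 * sqrt 2 < sqrt 2 * (u + (3 - 2 * sqrt 2)) + v"
    using assms sqrt2_bounds by (simp add: algebra_simps)
  then have "induced (u + (3 - 2 * sqrt 2), v) = (v, u)"
    by (subst induced_simps(1)) (simp_all add: v algebra_simps)
  then show ?thesis using induced_simps(2)[OF assms(2)] by (simp add: numeral_2_eq_2)
qed

text \<open>The part of the edge where \<open>u\<close> is smaller than on the diagonal returns to itself after five steps,
reversed about its midpoint. The numbers \<open>3 * sqrt 2 - 4\<close> and \<open>5 * sqrt 2 - 7\<close> are \<open>sqrt 2 * k\<^sup>2\<close> and
\<open>k ^ 3\<close> for \<open>k = sqrt 2 - 1\<close>.\<close>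

lemma edge_reflected:
  assumes "0 < u" "u < 5 * sqrt 2 - 7"
  shows "(induced ^^ 5) (u, 3 - 2 * sqrt 2 - sqrt 2 * u)
    = (5 * sqrt 2 - 7 - u, 3 - 2 * sqrt 2 - sqrt 2 * (5 * sqrt 2 - 7 - u))"
proof -
  define v where "v = 3 - 2 * sqrt 2 - sqrt 2 * u"
  have pos: "0 < sqrt 2 * u" "sqrt 2 * u < 10 - 7 * sqrt 2"
    using assms sqrt2_mono(2)[OF assms(2)] by (auto simp: algebra_simps)
  have "(u, v) \<in> triangle" using assms pos sqrt2_bounds
    by (simp add: triangle_iff v_def algebra_simps)
  then have 1: "(induced ^^ 2) (u, v) = (v, u)" by (rule induced_twice_edge) (simp add: v_def)
  have 2: "induced (v, u) = (u, 3 * sqrt 2 - 4)"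
    using assms by (subst induced_simps(1)) (simp_all add: v_def algebra_simps)
  have 3: "induced (u, 3 * sqrt 2 - 4) = (3 * sqrt 2 - 4, 5 * sqrt 2 - 7 - u)"
  proof -
    have "3 - 2 * sqrt 2 < sqrt 2 * u + (3 * sqrt 2 - 4)" using pos sqrt2_bounds by linarith
    then show ?thesis by (subst induced_simps(1)) (simp_all add: algebra_simps)
  qed
  have 4: "induced (3 * sqrt 2 - 4, 5 * sqrt 2 - 7 - u) = (5 * sqrt 2 - 7 - u, 5 * sqrt 2 - 7 + sqrt 2 * u)"
    using assms pos sqrt2_bounds by (subst induced_simps(1)) (simp_all add: algebra_simps)
  have "(induced ^^ (3 + 2)) (u, v) = (5 * sqrt 2 - 7 - u, 5 * sqrt 2 - 7 + sqrt 2 * u)"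
    unfolding funpow_add comp_def 1 by (simp add: numeral_3_eq_3 2 3 4)
  then show ?thesis by (simp add: v_def algebra_simps)
qed

text \<open>The edge is divided at its intersection with the diagonal, a point of period 2 under \<open>induced\<close>.
One part consists of periodic points, the other is reflected into the second piece.\<close>

lemma edge_cases:
  assumes "(u, v) \<in> triangle" "sqrt 2 * u + v = 3 - 2 * sqrt 2"
  shows "recurrent (u, v) \<or> sqrt 2 * v + u < 3 - 2 * sqrt 2"
proof (cases "sqrt 2 * v + u" "3 - 2 * sqrt 2" rule: linorder_cases)
  case equal
  then have "(sqrt 2 - 1) * (u - v) = 0" using assms(2) by (simp add: algebra_simps)
  then have "u = v" using sqrt2_bounds by simp
  then show ?thesis using induced_twice_edge[OF assms] recurrentI[of 2 "(u, v)"] by simp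
next
  case greater
  have v: "v = 3 - 2 * sqrt 2 - sqrt 2 * u" using assms by linarith
  have u: "0 < u" "u < 5 * sqrt 2 - 7" using assms greater by (auto simp: triangle_iff v algebra_simps)
  have "(induced ^^ (5 + 5)) (u, v) = (u, v)"
    unfolding funpow_add comp_def v using edge_reflected[OF u] edge_reflected[of "5 * sqrt 2 - 7 - u"] u
    by simp
  then show ?thesis using recurrentI[of "5 + 5" "(u, v)"] by simp
qed simp

section \<open>Conjugation of the coordinates\<close>

text \<open>A relation instead of a function: closure under the ring operations is then immediate from the
integer coefficients.\<close>

definition conjugate :: "real \<Rightarrow> real \<Rightarrow> bool" where
  "conjugate x x' \<longleftrightarrow> (\<exists>a b :: int. x = of_int a + of_int b * sqrt 2 \<and> x' = of_int a - of_int b * sqrt 2)"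

lemma conjugateI: "x = of_int a + of_int b * sqrt 2 \<Longrightarrow> x' = of_int a - of_int b * sqrt 2 \<Longrightarrow> conjugate x x'"
  unfolding conjugate_def by blast

lemma conjugate_simps:
  assumes "conjugate x x'" "conjugate y y'"
  shows "conjugate (x + y) (x' + y')" "conjugate (x - y) (x' - y')" "conjugate (x * y) (x' * y')"
proof -
  obtain a b c d where e: "x = of_int a + of_int b * sqrt 2" "x' = of_int a - of_int b * sqrt 2"
    "y = of_int c + of_int d * sqrt 2" "y' = of_int c - of_int d * sqrt 2"
    using assms unfolding conjugate_def by blast
  show "conjugate (x + y) (x' + y')" by (rule conjugateI[of _ "a + c" "b + d"]) (simp_all add: e algebra_simps)
  show "conjugate (x - y) (x' - y')" by (rule conjugateI[of _ "a - c" "b - d"]) (simp_all add: e algebra_simps)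
  show "conjugate (x * y) (x' * y')"
    by (rule conjugateI[of _ "a * c + 2 * (b * d)" "a * d + b * c"]) (simp_all add: e algebra_simps)
qed

lemma conjugate_sqrt2: "conjugate (sqrt 2) (- sqrt 2)"
  by (rule conjugateI[of _ 0 1]) auto

lemma conjugate_1: "conjugate 1 1"
  by (rule conjugateI[of _ 1 0]) auto

text \<open>In this complex coordinate the conjugate linear map \<open>(a, b) \<mapsto> (b, sqrt 2 * b - a)\<close> is the
multiplication by \<open>cis (- pi / 4)\<close>, which explains the invariant quadratic form in
\<open>height_square\<close>.\<close>

definition rotation_coordinate :: "real \<times> real \<Rightarrow> complex" where
  "rotation_coordinate p = Complex (fst p - snd p * (sqrt 2 / 2)) (snd p * (sqrt 2 / 2))"

definition height :: "real \<times> real \<Rightarrow> real" where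
  "height p = cmod (rotation_coordinate p)"

lemma height_square: "(height (a, b))\<^sup>2 = a\<^sup>2 - sqrt 2 * a * b + b\<^sup>2"
  unfolding height_def rotation_coordinate_def cmod_power2 by (simp add: power2_eq_square field_simps)

lemma height_nonneg: "0 \<le> height p" by (simp add: height_def)

lemma height_swap: "height (b, a) = height (a, b)"
  by (rule power2_eq_imp_eq) (simp_all add: height_square height_nonneg algebra_simps)

lemma height_rotate: "height (b, sqrt 2 * b - a) = height (a, b)"
  by (rule power2_eq_imp_eq)
    (simp_all only: height_square height_nonneg, simp add: power2_eq_square algebra_simps)

lemma height_scale: "height (c * a, c * b) = \<bar>c\<bar> * height (a, b)"
proof (rule power2_eq_imp_eq)
  show "(height (c * a, c * b))\<^sup>2 = (\<bar>c\<bar> * height (a, b))\<^sup>2"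
    unfolding power_mult_distrib height_square power2_abs by (simp add: power2_eq_square algebra_simps)
qed (simp_all add: height_nonneg)

lemma height_add_le: "height (a + c, b + d) \<le> height (a, b) + height (c, d)"
proof -
  have "rotation_coordinate (a + c, b + d) = rotation_coordinate (a, b) + rotation_coordinate (c, d)"
    by (simp add: rotation_coordinate_def complex_eq_iff algebra_simps)
  then show ?thesis unfolding height_def by (simp add: norm_triangle_ineq)
qed

lemma coordinate_le_height: "\<bar>b\<bar> \<le> sqrt 2 * height (a, b)" "\<bar>a\<bar> \<le> sqrt 2 * height (a, b)"
proof -
  have *: "\<bar>b\<bar> \<le> sqrt 2 * height (a, b)" for a b
  proof -
    have "\<bar>b\<bar> * (sqrt 2 / 2) \<le> height (a, b)"
      using abs_Im_le_cmod[of "rotation_coordinate (a, b)"] by (simp add: height_def rotation_coordinate_def abs_mult)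
    from sqrt2_mono(1)[OF this] show ?thesis by (simp add: algebra_simps)
  qed
  show "\<bar>b\<bar> \<le> sqrt 2 * height (a, b)" "\<bar>a\<bar> \<le> sqrt 2 * height (a, b)"
    using *[of b a] *[of a b] height_swap[of a b] by simp_all
qed

text \<open>The point \<open>(centre, centre)\<close> is the fixed point of the conjugate of the first branch of \<open>induced\<close>.\<close>

definition centre :: real where "centre = - 2 - 3 / 2 * sqrt 2"

lemma height_centre: "height (centre, centre) \<le> 16 / 5" "height (- centre, - centre) \<le> 16 / 5"
proof -
  have "(height (centre, centre))\<^sup>2 = 5 + 7 / 2 * sqrt 2"
    unfolding height_square by (simp add: centre_def power2_eq_square algebra_simps)
  also have "\<dots> \<le> (16 / 5)\<^sup>2" using sqrt2_bounds by (simp add: power2_eq_square)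
  finally show "height (centre, centre) \<le> 16 / 5" by (rule power2_le_imp_le) simp
  then show "height (- centre, - centre) \<le> 16 / 5" using height_scale[of "-1" centre centre] by simp
qed

text \<open>The pair \<open>p'\<close> consists of the conjugates of the coordinates of \<open>p\<close>, and \<open>r\<close> measures its distance
from the centre, which stays constant under the first branch and under the exchange of
coordinates.\<close>

definition tracked :: "real \<times> real \<Rightarrow> real \<times> real \<Rightarrow> real \<Rightarrow> bool" where
  "tracked p p' r \<longleftrightarrow> conjugate (fst p) (fst p') \<and> conjugate (snd p) (snd p')
     \<and> height (fst p' - centre, snd p' - centre) = r"

text \<open>If \<open>u\<close> were smaller, the bound on \<open>u - u'\<close> would leave only seven values for the coefficient of
\<open>sqrt 2\<close>, and for each of them the other coefficient would lie strictly between two consecutive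
integers.\<close>

lemma small_conjugates:
  assumes "conjugate u u'" "0 < u" "\<bar>u'\<bar> \<le> 17 / 2"
  shows "3 - 2 * sqrt 2 \<le> u"
proof (rule ccontr)
  assume "\<not> 3 - 2 * sqrt 2 \<le> u"
  then have less: "u < 3 - 2 * sqrt 2" by simp
  obtain a b where ab: "u = of_int a + of_int b * sqrt 2" "u' = of_int a - of_int b * sqrt 2"
    using assms(1) unfolding conjugate_def by blast
  have u: "0 < real_of_int a + of_int b * sqrt 2" "of_int a + of_int b * sqrt 2 < 3 - 2 * sqrt 2"
    using assms less ab by auto
  have "u - u' = 2 * sqrt 2 * of_int b" by (simp add: ab)
  then have "\<bar>2 * sqrt 2 * real_of_int b\<bar> \<le> 9" using assms less sqrt2_bounds by linarith
  moreover have "\<bar>2 * sqrt 2 * real_of_int b\<bar> = 2 * sqrt 2 * \<bar>real_of_int b\<bar>" by (simp add: abs_mult)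
  moreover have "2 * sqrt 2 * 4 \<le> 2 * sqrt 2 * \<bar>real_of_int b\<bar>" if "4 \<le> \<bar>b\<bar>"
    using that by (intro mult_left_mono) auto
  ultimately have "\<not> 4 \<le> \<bar>b\<bar>" using sqrt2_bounds by linarith
  then consider "b = -3" | "b = -2" | "b = -1" | "b = 0" | "b = 1" | "b = 2" | "b = 3" by linarith
  moreover have gap: False if "real_of_int m < a" "a < real_of_int m + 1" for m
    using that of_int_less_iff[of m a] of_int_less_iff[of a "m + 1"] by simp
  ultimately show False
  proof cases
    case 1 show ?thesis by (rule gap[of 4]) (use u[unfolded 1, simplified] sqrt2_bounds in linarith)+
  next
    case 2 show ?thesis by (rule gap[of 2]) (use u[unfolded 2, simplified] sqrt2_bounds in linarith)+
  next
    case 3 show ?thesis by (rule gap[of 1]) (use u[unfolded 3, simplified] sqrt2_bounds in linarith)+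
  next
    case 4 show ?thesis by (rule gap[of 0]) (use u[unfolded 4] sqrt2_bounds in linarith)+
  next
    case 5 show ?thesis by (rule gap[of "-2"]) (use u[unfolded 5, simplified] sqrt2_bounds in linarith)+
  next
    case 6 show ?thesis by (rule gap[of "-3"]) (use u[unfolded 6, simplified] sqrt2_bounds in linarith)+
  next
    case 7 show ?thesis by (rule gap[of "-5"]) (use u[unfolded 7, simplified] sqrt2_bounds in linarith)+
  qed
qed

text \<open>Height at most 6 bounds both conjugates by \<open>6 * sqrt 2 < 17 / 2\<close>, and then both coordinates are at
least \<open>3 - 2 * sqrt 2\<close>. But the point \<open>(3 - 2 * sqrt 2, 3 - 2 * sqrt 2)\<close> already lies on the
hypotenuse of the triangle.\<close>

lemma no_low_points:
  assumes "(u, v) \<in> triangle" "conjugate u u'" "conjugate v v'" "height (u', v') \<le> 6"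
  shows False
proof -
  have uv: "0 < u" "0 < v" "u + sqrt 2 * v < sqrt 2 - 1" using assms by (auto simp: triangle_iff)
  have "sqrt 2 * height (u', v') \<le> sqrt 2 * 6" using assms by auto
  then have "\<bar>u'\<bar> \<le> 17 / 2" "\<bar>v'\<bar> \<le> 17 / 2"
    using coordinate_le_height(1)[of v' u'] coordinate_le_height(2)[of u' v'] sqrt2_bounds by linarith+
  then have "3 - 2 * sqrt 2 \<le> u" "3 - 2 * sqrt 2 \<le> v"
    using small_conjugates assms(2,3) uv by blast+
  then show False using sqrt2_mono(1)[of "3 - 2 * sqrt 2" v] uv by (simp add: algebra_simps)
qed

lemma tracked_induced:
  assumes "tracked p p' r" "3 - 2 * sqrt 2 < sqrt 2 * fst p + snd p"
  shows "tracked (induced p) (snd p', - sqrt 2 - 1 - fst p' + sqrt 2 * snd p') r"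
proof -
  have "induced p = (snd p, sqrt 2 - 1 - fst p - sqrt 2 * snd p)"
    using induced_simps(1)[of "fst p" "snd p"] assms by simp
  moreover have "conjugate (sqrt 2 - 1 - fst p - sqrt 2 * snd p) (- sqrt 2 - 1 - fst p' - (- sqrt 2) * snd p')"
    using assms unfolding tracked_def by (intro conjugate_simps conjugate_sqrt2 conjugate_1) auto
  moreover have "height (snd p' - centre, - sqrt 2 - 1 - fst p' + sqrt 2 * snd p' - centre) = height (fst p' - centre, snd p' - centre)"
  proof -
    have "- sqrt 2 - 1 - fst p' + sqrt 2 * snd p' - centre = sqrt 2 * (snd p' - centre) - (fst p' - centre)"
      by (simp add: centre_def algebra_simps)
    then show ?thesis using height_rotate by metis
  qed
  ultimately show ?thesis using assms(1) by (simp add: tracked_def)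
qed

section \<open>Periodicity for coordinates in the ring\<close>

text \<open>Follow the orbit through the first piece until it leaves it. If it meets the edge, the edge
analysis applies, and the reflected point has the same distance from the centre.\<close>

lemma recurrent_or_renormalizable:
  assumes "p \<in> triangle" "tracked p p' r"
  shows "recurrent p \<or> (\<exists>n q'. tracked ((induced ^^ n) p) q' r
    \<and> sqrt 2 * fst ((induced ^^ n) p) + snd ((induced ^^ n) p) < 3 - 2 * sqrt 2)"
proof -
  let ?A = "\<lambda>i. 3 - 2 * sqrt 2 < sqrt 2 * fst ((induced ^^ i) p) + snd ((induced ^^ i) p)"
  show ?thesis
  proof (cases "\<forall>i<8. ?A i")
    case True
    then have "(induced ^^ 8) p = p" by (intro induced_eight) auto
    then show ?thesis using recurrentI[of 8 p] by simp
  next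
    case False
    define i where "i = (LEAST i. \<not> ?A i)"
    have i: "\<not> ?A i" "\<And>j. j < i \<Longrightarrow> ?A j"
      using False LeastI_ex[of "\<lambda>i. \<not> ?A i"] not_less_Least[of _ "\<lambda>i. \<not> ?A i"] unfolding i_def by blast+
    have "j \<le> i \<Longrightarrow> \<exists>q'. tracked ((induced ^^ j) p) q' r" for j
    proof (induction j)
      case (Suc j)
      then obtain q' where "tracked ((induced ^^ j) p) q' r" by auto
      then show ?case using tracked_induced i(2)[of j] Suc by fastforce
    next
      case 0
      have "tracked ((induced ^^ 0) p) p' r" using assms by simp
      then show ?case by blast
    qed
    then obtain q' where q': "tracked ((induced ^^ i) p) q' r" by blast
    obtain u v where uv: "(induced ^^ i) p = (u, v)" by force
    have triangle: "(u, v) \<in> triangle" using funpow_induced_triangle[OF assms(1), of i] uv by simp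
    show ?thesis
    proof (cases "sqrt 2 * u + v = 3 - 2 * sqrt 2")
      case False
      then have "sqrt 2 * u + v < 3 - 2 * sqrt 2" using i(1) uv by simp
      then show ?thesis using q' uv by (metis fst_conv snd_conv)
    next
      case True
      have "(induced ^^ (2 + i)) p = (v, u)" unfolding funpow_add comp_def uv by (rule induced_twice_edge[OF triangle True])
      moreover have "tracked (v, u) (snd q', fst q') r"
        using q' uv height_swap by (simp add: tracked_def)
      ultimately show ?thesis
        using edge_cases[OF triangle True] recurrent_backwards[of i p] uv
        by (metis fst_conv snd_conv)
    qed
  qed
qed

text \<open>Before the second piece is reached the height grows by at most \<open>2 * (16 / 5)\<close>, twice the height of
the centre; magnification multiplies it by \<open>sqrt 2 - 1\<close>. As \<open>sqrt 2 - 1 \<le> 83 / 200\<close> and so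
\<open>(sqrt 2 - 1) * (7 + n + 32 / 5) \<le> 6 + n\<close>, each magnification brings the point down by one
level of the induction.\<close>

lemma conjugate_recurrent:
  assumes "(u, v) \<in> triangle" "conjugate u u'" "conjugate v v'" "height (u', v') \<le> 6 + real n"
  shows "recurrent (u, v)"
  using assms
proof (induction n arbitrary: u v u' v')
  case 0
  then show ?case using no_low_points[OF 0(1-3)] by simp
next
  case (Suc n)
  define r where "r = height (u' - centre, v' - centre)"
  have "tracked (u, v) (u', v') r" using Suc.prems by (simp add: tracked_def r_def)
  from recurrent_or_renormalizable[OF Suc.prems(1) this] show ?case
  proof (elim disjE exE conjE)
    fix m q'
    assume ch: "tracked ((induced ^^ m) (u, v)) q' r"
      and small: "sqrt 2 * fst ((induced ^^ m) (u, v)) + snd ((induced ^^ m) (u, v)) < 3 - 2 * sqrt 2"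
    obtain a b where ab: "(induced ^^ m) (u, v) = (a, b)" by force
    obtain a' b' where ab': "q' = (a', b')" by force
    have triangle: "(a, b) \<in> triangle" using funpow_induced_triangle[OF Suc.prems(1), of m] ab by simp
    have small: "sqrt 2 * a + b < 3 - 2 * sqrt 2" using small ab by simp
    define w where "w = ((sqrt 2 + 1) * b, (sqrt 2 + 1) * a)"
    have "shrink w = (a, b)" by (simp add: w_def shrink_def algebra_simps)
    have "w \<in> triangle"
    proof -
      have "(sqrt 2 + 1) * (sqrt 2 * a + b) < (sqrt 2 + 1) * (3 - 2 * sqrt 2)"
        using small by (intro mult_strict_left_mono) (auto intro: add_pos_pos)
      moreover have "0 < (sqrt 2 + 1) * a" "0 < (sqrt 2 + 1) * b" using triangle by (auto simp: triangle_iff add_pos_pos)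
      ultimately show ?thesis by (simp add: w_def triangle_iff algebra_simps)
    qed
    have "conjugate (sqrt 2 + 1) (- sqrt 2 + 1)" by (intro conjugate_simps conjugate_sqrt2 conjugate_1)
    then have conj: "conjugate ((sqrt 2 + 1) * b) ((- sqrt 2 + 1) * b')" "conjugate ((sqrt 2 + 1) * a) ((- sqrt 2 + 1) * a')"
      using ch unfolding tracked_def ab ab' by (auto intro!: conjugate_simps(3))
    have h1: "height (a', b') \<le> r + 16 / 5"
      using height_add_le[of "a' - centre" centre "b' - centre" centre] height_centre ch unfolding tracked_def ab ab' by simp
    have h2: "r \<le> height (u', v') + 16 / 5"
      using height_add_le[of u' "- centre" v' "- centre"] height_centre by (simp add: r_def)
    have "height ((- sqrt 2 + 1) * b', (- sqrt 2 + 1) * a') = (sqrt 2 - 1) * height (a', b')"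
      using sqrt2_bounds unfolding height_scale height_swap[of b' a'] by simp
    also have "\<dots> \<le> 83 / 200 * (67 / 5 + real n)"
      using h1 h2 Suc.prems(4) sqrt2_bounds by (intro mult_mono) (auto simp: height_nonneg)
    also have "\<dots> \<le> 6 + real n" by simp
    finally have "recurrent w"
      using Suc.IH[OF _ conj] \<open>w \<in> triangle\<close> by (simp add: w_def)
    then have "recurrent (shrink w)" using \<open>w \<in> triangle\<close> by (rule recurrent_shrink[rotated])
    then show ?case using \<open>shrink w = (a, b)\<close> ab recurrent_backwards[of m] by metis
  qed
qed

lemma Z_sqrt2_conjugate: "x \<in> Z_sqrt2 \<longleftrightarrow> (\<exists>x'. conjugate x x')"
  by (auto simp: Z_sqrt2_def conjugate_def)

lemma T_Z_sqrt2:
  assumes "fst z \<in> Z_sqrt2" "snd z \<in> Z_sqrt2"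
  shows "fst ((T ^^ k) z) \<in> Z_sqrt2 \<and> snd ((T ^^ k) z) \<in> Z_sqrt2"
proof (induction k)
  case (Suc k)
  define w where "w = (T ^^ k) z"
  obtain x' y' where xy: "conjugate (fst w) x'" "conjugate (snd w) y'"
    using Suc unfolding Z_sqrt2_conjugate w_def by blast
  have "conjugate (of_int (letter w)) (of_int (letter w))" by (rule conjugateI[of _ "letter w" 0]) auto
  then have "conjugate (of_int (letter w) - fst w - sqrt 2 * snd w) (of_int (letter w) - x' - (- sqrt 2) * y')"
    using xy by (intro conjugate_simps conjugate_sqrt2)
  then show ?case using Suc T_letter[of w] by (auto simp: Z_sqrt2_conjugate w_def)
qed (use assms in auto)

lemma Z_sqrt2_periodic:
  assumes "z \<in> unit_square" "fst z \<in> Z_sqrt2" "snd z \<in> Z_sqrt2"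
  shows "periodic z"
proof -
  consider "periodic z" | k where "2 < fst ((T ^^ k) z) + sqrt 2 * snd ((T ^^ k) z)"
    using periodic_or_letter_3[OF assms(1)] by blast
  then show ?thesis
  proof cases
    case 2
    obtain x y where xy: "(T ^^ k) z = (x, y)" by force
    have "(x, y) \<in> unit_square" using funpow_T_mem[OF assms(1), of k] xy by simp
    then have triangle: "(1 - x, 1 - y) \<in> triangle"
      using 2 by (auto simp: xy triangle_iff unit_square_def algebra_simps)
    obtain x' y' where "conjugate x x'" "conjugate y y'"
      using T_Z_sqrt2[OF assms(2,3), of k] unfolding Z_sqrt2_conjugate xy by auto
    then have c: "conjugate (1 - x) (1 - x')" "conjugate (1 - y) (1 - y')"
      by (auto intro!: conjugate_simps conjugate_1)
    obtain n where "height (1 - x', 1 - y') - 6 \<le> real n" using real_arch_simple by blast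
    then have "recurrent (1 - x, 1 - y)" by (intro conjugate_recurrent[OF triangle c, of n]) simp
    then have "periodic ((T ^^ k) z)" using recurrent_periodic[OF triangle] by (simp add: xy corner_def)
    then show ?thesis by (rule periodic_backwards[OF assms(1)])
  qed
qed

section \<open>An aperiodic orbit\<close>

definition reaches where "reaches p q \<longleftrightarrow> (\<exists>n. (induced ^^ n) p = q)"

lemma reaches_trans: "reaches p q \<Longrightarrow> reaches q t \<Longrightarrow> reaches p t"
  unfolding reaches_def by (metis comp_apply funpow_add)

lemma reaches_shrink: "p \<in> triangle \<Longrightarrow> reaches p q \<Longrightarrow> reaches (shrink p) (shrink q)"
  unfolding reaches_def using funpow_induced_renormalized by metis

lemma funpow_shrink_triangle: "p \<in> triangle \<Longrightarrow> (shrink ^^ n) p \<in> triangle"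
  by (induction n) (auto simp: shrink_triangle)

lemma reaches_funpow_shrink: "p \<in> triangle \<Longrightarrow> reaches p q \<Longrightarrow> reaches ((shrink ^^ n) p) ((shrink ^^ n) q)"
  by (induction n) (auto simp: reaches_shrink funpow_shrink_triangle)

definition start :: "real \<times> real" where "start = (1 / 4, (sqrt 2 - 1) / 4)"

lemma corner_start: "corner start = (3 / 4, (5 - sqrt 2) / 4)"
  by (simp add: corner_def start_def field_simps)

lemma start_triangle: "start \<in> triangle"
  using sqrt2_bounds by (simp add: start_def triangle_iff field_simps)

text \<open>The points \<open>w1\<close>, \<open>w2\<close>, \<open>w3\<close> are the successive magnifications of the orbit of \<open>start\<close>. The fourth
one is \<open>start\<close> again.\<close>

lemma start_reaches: "reaches start ((shrink ^^ 4) start)"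
proof -
  define w1 where "w1 = (3 / 4 - sqrt 2 / 2, 1 / 4 :: real)"
  define w2 where "w2 = (7 / 4 - sqrt 2, 3 / 4 - sqrt 2 / 2)"
  define w3 where "w3 = (3 / 4 - sqrt 2 / 2, (sqrt 2 - 1) / 4)"
  have triangle: "w1 \<in> triangle" "w2 \<in> triangle" "w3 \<in> triangle"
    using sqrt2_bounds by (simp_all add: w1_def w2_def w3_def triangle_iff field_simps)
  have "induced start = shrink w1"
    using sqrt2_bounds by (simp add: start_def w1_def shrink_def induced_def field_simps)
  then have 0: "reaches start (shrink w1)" unfolding reaches_def by (intro exI[of _ 1]) simp
  have "induced (induced w1) = shrink w2"
    using sqrt2_bounds by (simp add: w1_def w2_def shrink_def induced_def field_simps)
  then have 1: "reaches w1 (shrink w2)" unfolding reaches_def by (intro exI[of _ 2]) (simp add: numeral_2_eq_2)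
  have "induced w2 = shrink w3"
    using sqrt2_bounds by (simp add: w2_def w3_def shrink_def induced_def field_simps)
  then have 2: "reaches w2 (shrink w3)" unfolding reaches_def by (intro exI[of _ 1]) simp
  have 3: "w3 = shrink start" by (simp add: start_def w3_def shrink_def field_simps)
  have "reaches w1 ((shrink ^^ 3) start)"
    using reaches_trans[OF 1 reaches_shrink[OF triangle(2) 2]] by (simp add: 3 numeral_3_eq_3)
  then show ?thesis
    using reaches_trans[OF 0 reaches_shrink[OF triangle(1)]] by (simp add: numeral_eq_Suc)
qed

text \<open>The relation \<open>reaches\<close> is preserved by \<open>shrink\<close>, so a single self-similarity can be iterated.\<close>

lemma start_reaches_all: "reaches start ((shrink ^^ (4 * n)) start)"
proof (induction n)
  case 0 show ?case unfolding reaches_def by (intro exI[of _ 0]) simp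
next
  case (Suc n)
  have "reaches ((shrink ^^ (4 * n)) start) ((shrink ^^ (4 * n)) ((shrink ^^ 4) start))"
    by (rule reaches_funpow_shrink[OF start_triangle start_reaches])
  then have "reaches ((shrink ^^ (4 * n)) start) ((shrink ^^ (4 * n + 4)) start)"
    by (simp only: funpow_add comp_apply)
  then show ?case using reaches_trans[OF Suc] by (simp add: ac_simps)
qed

lemma funpow_shrink_4: "(shrink ^^ (4 * n)) p = ((sqrt 2 - 1) ^ (4 * n) * fst p, (sqrt 2 - 1) ^ (4 * n) * snd p)"
proof (induction n)
  case (Suc n)
  have "(shrink ^^ 4) q = ((sqrt 2 - 1) ^ 4 * fst q, (sqrt 2 - 1) ^ 4 * snd q)" for q
    by (simp add: numeral_eq_Suc shrink_def mult.assoc)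
  then have "(shrink ^^ (4 + 4 * n)) p = ((sqrt 2 - 1) ^ 4 * ((sqrt 2 - 1) ^ (4 * n) * fst p),
      (sqrt 2 - 1) ^ 4 * ((sqrt 2 - 1) ^ (4 * n) * snd p))"
    unfolding funpow_add comp_apply Suc by simp
  then show ?case by (simp only: mult_Suc_right power_add mult.assoc)
qed simp

lemma start_not_periodic: "\<not> periodic (corner start)"
proof
  let ?orbit = "\<lambda>n. (T ^^ n) (corner start)" and ?copy = "\<lambda>n. corner ((shrink ^^ (4 * n)) start)"
  assume "periodic (corner start)"
  then obtain p where p: "p \<ge> 1" "?orbit p = corner start" unfolding periodic_def by blast
  have "range ?orbit \<subseteq> ?orbit ` {..<p}"
  proof (rule image_subsetI)
    fix n
    have "?orbit n = ?orbit (n mod p)" using p(2) by (simp add: funpow_mod_eq)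
    then show "?orbit n \<in> ?orbit ` {..<p}" using p(1) by (intro image_eqI[of _ _ "n mod p"]) auto
  qed
  then have "finite (range ?orbit)" by (rule finite_subset) simp
  moreover have "range ?copy \<subseteq> range ?orbit"
  proof (rule image_subsetI)
    fix n
    obtain m where "(induced ^^ m) start = (shrink ^^ (4 * n)) start"
      using start_reaches_all[of n] unfolding reaches_def by blast
    then obtain l where "?orbit l = ?copy n"
      using funpow_induced_reached[OF start_triangle, of m] by auto
    then show "?copy n \<in> range ?orbit" by (metis rangeI)
  qed
  ultimately have "finite (range ?copy)" using finite_subset by blast
  moreover have "inj ?copy"
  proof -
    have "(sqrt 2 - 1) ^ (4 * m) < (sqrt 2 - 1) ^ (4 * n)" if "n < m" for n m :: nat
      using that sqrt2_bounds by (intro power_strict_decreasing) auto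
    then show ?thesis
      by (intro linorder_injI) (fastforce simp: funpow_shrink_4 corner_def start_def)
  qed
  ultimately show False using finite_imageD infinite_UNIV_nat by blast
qed

lemma period_finite: "periodic z \<Longrightarrow> period z < \<infinity>"
  unfolding periodic_def period_def by simp

theorem theorem6p2:
  shows "(\<forall>z \<in> (Z_sqrt2 \<inter> {0..<1}) \<times> (Z_sqrt2 \<inter> {0..<1}). period z < \<infinity>) \<and>
    aperiodic (\<lambda>k. T_pow k (3 / 4, (5 - sqrt 2) / 4))"
proof (intro conjI ballI)
  fix z assume "z \<in> (Z_sqrt2 \<inter> {0..<1}) \<times> (Z_sqrt2 \<inter> {0..<1})"
  then have "z \<in> unit_square" "fst z \<in> Z_sqrt2" "snd z \<in> Z_sqrt2" by (auto simp: unit_square_def)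
  then show "period z < \<infinity>" by (intro period_finite Z_sqrt2_periodic)
next
  have "period (corner start) = \<infinity>" using start_not_periodic unfolding periodic_def period_def by simp
  then show "aperiodic (\<lambda>k. T_pow k (3 / 4, (5 - sqrt 2) / 4))"
    using aperiodic_iff_period[OF corner_triangle[OF start_triangle]] by (simp add: corner_start)
qed

end
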